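(* Let $\boldsymbol d=\boldsymbol d(n)=(d_1,\ldots,d_n)$ be a graphical degree sequence with all degrees positive and even, and assume $d_{\mathrm{max}}^2=o(\bar d n)$. Let $G\sim\mathcal G(n,\boldsymbol d)$. Then for any $\mu=\mu(n)>0$, \[ \Pr\bigl(\rho(G)\ge\widehat\rho(G)+\mu\bigr)\le\frac{1}{e^{n\mu}-1}\,n^{1/2}e^{O(d_{\mathrm{max}}^2)}, \] where the implied constant does not depend on $\mu$.
   Context: $\mathcal G(n,\boldsymbol d)$ is the uniform probability space of simple graphs on vertex set $\{1,\ldots,n\}$ with degree sequence $\boldsymbol d$; $\bar d$ and $d_{\mathrm{max}}$ are the average and maximum of $\boldsymbol d$. For such $G$, $\operatorname{EO}(G)$ is the number of orientations of the edges such that every vertex has in-degree equal to out-degree; $\rho(G):=\frac1n\log\operatorname{EO}(G)$ and $\widehat\rho(G):=\frac1n\sum_{i=1}^n\bigl(\log\binom{d_i}{d_i/2}-\frac{d_i}{2}\log 2\bigr)$. Asymptotics are as $n\to\infty$. *)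

theory Defs
  imports "HOL-Probability.Probability" "HOL-Library.Landau_Symbols" "HOL-Library.Ramsey"
begin

text \<open>A simple graph on the vertex set \<open>{1..n}\<close> is given by its set of edges, that is, by a
  subset of \<open>nsets {1..n} 2\<close>.\<close>

definition vertex_degree :: "nat set set \<Rightarrow> nat \<Rightarrow> nat" where
  "vertex_degree G v = card {e \<in> G. v \<in> e}"

definition graphs_with_degrees :: "nat \<Rightarrow> (nat \<Rightarrow> nat) \<Rightarrow> nat set set set" where
  "graphs_with_degrees n d =
     {G. G \<subseteq> nsets {1..n} 2 \<and> (\<forall>i\<in>{1..n}. vertex_degree G i = d i)}"

definition graphical :: "nat \<Rightarrow> (nat \<Rightarrow> nat) \<Rightarrow> bool" where
  "graphical n d \<longleftrightarrow> graphs_with_degrees n d \<noteq> {}"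

text \<open>Only meaningful if \<open>graphical n d\<close>: \<^const>\<open>pmf_of_set\<close> is unspecified on the empty set.\<close>

definition random_graph :: "nat \<Rightarrow> (nat \<Rightarrow> nat) \<Rightarrow> nat set set pmf" where
  "random_graph n d = pmf_of_set (graphs_with_degrees n d)"

definition avg_degree :: "nat \<Rightarrow> (nat \<Rightarrow> nat) \<Rightarrow> real" where
  "avg_degree n d = (\<Sum>i=1..n. real (d i)) / real n"

definition max_degree :: "nat \<Rightarrow> (nat \<Rightarrow> nat) \<Rightarrow> nat" where
  "max_degree n d = Max (d ` {1..n})"

text \<open>An orientation is the set of its arcs; as edges have two elements, the bijection says that
  exactly one of \<open>(u, v)\<close> and \<open>(v, u)\<close> is chosen for every edge \<open>{u, v}\<close>, and nothing else.\<close>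

definition orientation_of :: "nat set set \<Rightarrow> (nat \<times> nat) set \<Rightarrow> bool" where
  "orientation_of G A \<longleftrightarrow> bij_betw (\<lambda>(u, v). {u, v}) A G"

definition indegree :: "(nat \<times> nat) set \<Rightarrow> nat \<Rightarrow> nat" where
  "indegree A v = card {u. (u, v) \<in> A}"

definition outdegree :: "(nat \<times> nat) set \<Rightarrow> nat \<Rightarrow> nat" where
  "outdegree A v = card {w. (v, w) \<in> A}"

text \<open>Requiring balance at every natural number is harmless: outside the vertex set both degrees
  are zero.\<close>

definition EO :: "nat set set \<Rightarrow> nat" where
  "EO G = card {A. orientation_of G A \<and> (\<forall>v. indegree A v = outdegree A v)}"

definition rho :: "nat \<Rightarrow> nat set set \<Rightarrow> real" where
  "rho n G = 1 / real n * ln (real (EO G))"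

definition rho_hat :: "nat \<Rightarrow> (nat \<Rightarrow> nat) \<Rightarrow> real" where
  "rho_hat n d =
     1 / real n * (\<Sum>i=1..n. ln (real (d i choose (d i div 2))) - real (d i) / 2 * ln 2)"

end

theory Submission
  imports Defs "HOL-Combinatorics.Multiset_Permutations"
begin

text \<open>By Markov's inequality it suffices to bound the mean of \<open>EO\<close>, that is, the number of
  Eulerian oriented graphs divided by the number of graphs. With \<open>m\<close> edges and \<open>k\<^sub>i = d\<^sub>i / 2\<close>, listing
  the arcs in any order shows that there are at most \<open>m! / (\<Prod>k\<^sub>i!)\<^sup>2\<close> oriented graphs. Listing the
  edges shows that the number of graphs is \<open>(2m)! / (m! 2\<^sup>m \<Prod>d\<^sub>i!)\<close> times the probability that a
  random arrangement of the multiset with \<open>d\<^sub>i\<close> copies of each \<open>i\<close>, cut into \<open>m\<close> pairs, is simple.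
  Revealing the pairs one at a time and swapping one end of the newest pair with a random entry, one
  finds that each pair spoils simplicity with conditional probability \<open>O(\<Delta>\<^sup>2 / m)\<close>, where \<open>\<Delta>\<close> is the
  maximum degree. So the probability is \<open>exp (- O(\<Delta>\<^sup>2))\<close>, and \<open>(2m choose m) \<ge> 4\<^sup>m / (2 \<surd>m)\<close> gives
  the bound.\<close>

section \<open>The probability that a random arrangement is simple\<close>

text \<open>A list of length \<open>2 * m\<close> encodes \<open>m\<close> pairs: the ends of the pair \<open>s < m\<close> are at the positions
  \<open>s\<close> and \<open>m + s\<close>.\<close>

definition edge_at :: "nat \<Rightarrow> 'a list \<Rightarrow> nat \<Rightarrow> 'a set" where
  "edge_at m w s = {w ! s, w ! (m + s)}"

text \<open>Stages of revealing the pairs: stage 0 always holds, and at stage \<open>m\<close> the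
  pairs are the distinct edges of a loopless graph.\<close>

definition simple_upto :: "nat \<Rightarrow> nat \<Rightarrow> 'a list \<Rightarrow> bool" where
  "simple_upto m t w \<longleftrightarrow> (\<forall>s<t. w ! s \<noteq> w ! (m + s)) \<and> inj_on (edge_at m w) {..<t}"

text \<open>The position of the other end of the pair that contains \<open>r\<close>.\<close>

definition partner :: "nat \<Rightarrow> nat \<Rightarrow> nat" where
  "partner m r = (if r < m then m + r else r - m)"

definition swap_entries :: "nat \<Rightarrow> nat \<Rightarrow> 'a list \<Rightarrow> 'a list" where
  "swap_entries i j w = w[j := w ! i, i := w ! j]"

text \<open>The positions whose entry must not be joined to \<open>c\<close>, as this would create a loop or repeat
  one of the first \<open>t\<close> edges.\<close>

definition blocked :: "nat \<Rightarrow> nat \<Rightarrow> 'a list \<Rightarrow> 'a \<Rightarrow> nat set" where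
  "blocked m t w c = {r. r < 2 * m \<and> (w ! r = c \<or> (\<exists>s<t. edge_at m w s = {c, w ! r}))}"

section \<open>Counting blocked positions\<close>

lemma partner_less: "r < 2 * m \<Longrightarrow> partner m r < 2 * m"
  by (auto simp: partner_def)

lemma partner_partner: "r < 2 * m \<Longrightarrow> partner m (partner m r) = r"
  by (auto simp: partner_def)

lemma card_positions:
  "card {r. r < length w \<and> w ! r = c} = count (mset w) c"
  by (simp add: count_mset count_list_eq_length_filter length_filter_conv_card eq_commute[of c])

text \<open>At most \<Delta> positions hold \<open>c\<close> itself. Any other blocked entry shares
  a pair with an occurrence of \<open>c\<close>, so it takes at most \<Delta> values, and each value
  occupies at most \<Delta> positions.\<close>

lemma card_blocked_le:
  assumes len: "length w = 2 * m" and t: "t \<le> m"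
    and cnt: "\<And>x. count (mset w) x \<le> \<Delta>"
  shows "card (blocked m t w c) \<le> \<Delta> + \<Delta> * \<Delta>"
proof -
  define P where "P x = {r. r < 2 * m \<and> w ! r = x}" for x
  define N where "N = (\<lambda>r. w ! partner m r) ` P c"
  have fin: "finite (P x)" for x
    by (auto simp: P_def)
  have P: "card (P x) \<le> \<Delta>" for x
    using cnt[of x] card_positions[of w x] by (simp add: P_def len)
  have "card N \<le> card (P c)"
    unfolding N_def by (rule card_image_le[OF fin])
  with P[of c] have N: "card N \<le> \<Delta>" by linarith
  have "w ! r \<in> N" if "s < t" "edge_at m w s = {c, w ! r}" for r s
  proof -
    from that(2) have "w ! s = c \<and> w ! (m + s) = w ! r \<or> w ! (m + s) = c \<and> w ! s = w ! r"
      by (auto simp: edge_at_def doubleton_eq_iff)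
    then show ?thesis
    proof
      assume "w ! s = c \<and> w ! (m + s) = w ! r"
      then show ?thesis
        using that(1) t by (auto simp: N_def P_def partner_def intro!: image_eqI[of _ _ s])
    next
      assume "w ! (m + s) = c \<and> w ! s = w ! r"
      then show ?thesis
        using that(1) t by (auto simp: N_def P_def partner_def intro!: image_eqI[of _ _ "m + s"])
    qed
  qed
  then have "blocked m t w c \<subseteq> P c \<union> (\<Union>x\<in>N. P x)"
    by (auto simp: blocked_def P_def)
  then have "card (blocked m t w c) \<le> card (P c \<union> (\<Union>x\<in>N. P x))"
    by (intro card_mono) (auto simp: fin N_def)
  also have "\<dots> \<le> card (P c) + (\<Sum>x\<in>N. card (P x))"
    by (intro order.trans[OF card_Un_le] add_left_mono card_UN_le) (auto simp: N_def fin)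
  also have "(\<Sum>x\<in>N. card (P x)) \<le> (\<Sum>x\<in>N. \<Delta>)"
    by (intro sum_mono P)
  also have "\<dots> \<le> \<Delta> * \<Delta>"
    using N by simp
  finally show ?thesis
    using P[of c] by linarith
qed

section \<open>Swaps that preserve simplicity\<close>

lemma length_swap_entries [simp]: "length (swap_entries i j w) = length w"
  by (simp add: swap_entries_def)

lemma mset_swap_entries:
  "i < length w \<Longrightarrow> j < length w \<Longrightarrow> mset (swap_entries i j w) = mset w"
  by (simp add: swap_entries_def mset_swap)

lemma nth_swap_entries:
  "i < length w \<Longrightarrow> j < length w \<Longrightarrow>
    swap_entries i j w ! k = (if k = i then w ! j else if k = j then w ! i else w ! k)"
  by (auto simp: swap_entries_def nth_list_update)

lemma swap_entries_swap_entries: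
  "i < length w \<Longrightarrow> j < length w \<Longrightarrow> swap_entries i j (swap_entries i j w) = w"
  by (rule nth_equalityI) (auto simp: nth_swap_entries)

text \<open>Apart from the pair \<open>t\<close>, only the pair containing \<open>r\<close> changes:
  it keeps the entry at \<open>partner m r\<close> and receives the old entry of
  \<open>m + t\<close>.\<close>

lemma edge_at_swap_entries:
  assumes "length w = 2 * m" "t < m" "r < 2 * m" "r \<noteq> t" "r \<noteq> m + t" "s < m" "s \<noteq> t"
  shows "edge_at m (swap_entries r (m + t) w) s =
    (if r = s \<or> r = m + s then {w ! (m + t), w ! partner m r} else edge_at m w s)"
  using assms by (auto simp: edge_at_def nth_swap_entries partner_def)

text \<open>At most one of the first \<open>t\<close> edges changes. Its new ends are
  \<open>w ! (m + t)\<close> and \<open>w ! partner m r\<close>; as \<open>partner m r\<close> is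
  not blocked, this is neither a loop nor one of the old edges.\<close>

lemma simple_upto_swap_entries:
  assumes len: "length w = 2 * m" and t: "t < m" and simple: "simple_upto m t w"
    and r: "r < 2 * m" "r \<noteq> t" "r \<noteq> m + t" "partner m r \<notin> blocked m t w (w ! (m + t))"
  shows "simple_upto m t (swap_entries r (m + t) w)"
proof -
  let ?w = "swap_entries r (m + t) w"
  let ?e = "{w ! (m + t), w ! partner m r}"
  have e: "edge_at m ?w s = (if r = s \<or> r = m + s then ?e else edge_at m w s)" if "s < t" for s
    using that t by (intro edge_at_swap_entries[OF len t r(1-3)]) auto
  have fresh: "edge_at m w s \<noteq> ?e" if "s < t" for s
    using r(4) that partner_less[OF r(1)] by (auto simp: blocked_def)
  have proper: "w ! partner m r \<noteq> w ! (m + t)"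
    using r(4) partner_less[OF r(1)] by (auto simp: blocked_def)
  have inj: "inj_on (edge_at m w) {..<t}"
    using simple by (simp add: simple_upto_def)
  have "inj_on (edge_at m ?w) {..<t}"
  proof (rule inj_onI)
    fix s s' assume s: "s \<in> {..<t}" "s' \<in> {..<t}" and eq: "edge_at m ?w s = edge_at m ?w s'"
    from s t have "s < m" "s' < m" by auto
    then show "s = s'"
      using eq s fresh[of s] fresh[of s'] inj_onD[OF inj, of s s'] r(1)
      by (auto simp: e split: if_splits)
  qed
  moreover have "?w ! s \<noteq> ?w ! (m + s)" if "s < t" for s
  proof -
    have "w ! s \<noteq> w ! (m + s)"
      using simple that by (simp add: simple_upto_def)
    \<comment> \<open>Having two elements expresses looplessness of the edge as a set, so the
      changed and the unchanged edges are treated alike.\<close>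
    then have "card (edge_at m w s) = 2" by (simp add: edge_at_def)
    moreover have "card ?e = 2" using proper by simp
    ultimately have "card (edge_at m ?w s) = 2" by (simp only: e[OF that] split: if_split) simp
    then show ?thesis by (auto simp: edge_at_def)
  qed
  ultimately show ?thesis by (simp add: simple_upto_def)
qed

lemma bad_edge:
  assumes "simple_upto m t w" "\<not> simple_upto m (Suc t) w"
  shows "w ! t = w ! (m + t) \<or> (\<exists>s<t. edge_at m w s = edge_at m w t)"
  using assms by (auto simp: simple_upto_def lessThan_Suc less_Suc_eq)

text \<open>Let the pair \<open>s\<close> witness that the pair \<open>t\<close> is bad. If
  \<open>r\<close> lies in neither pair and its partner is not blocked, the swap keeps the first
  \<open>t\<close> edges simple and moves \<open>w ! (m + t)\<close> to \<open>r\<close>. The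
  witness survives the swap, so joining \<open>w ! t\<close> to the entry at \<open>r\<close> is
  still forbidden.\<close>

lemma card_switchable_ge:
  assumes len: "length w = 2 * m" and t: "t < m" and cnt: "\<And>x. count (mset w) x \<le> \<Delta>"
    and simple: "simple_upto m t w" and bad: "\<not> simple_upto m (Suc t) w"
  shows "2 * m \<le> 4 + \<Delta> + \<Delta> * \<Delta> +
    card {r. r < 2 * m \<and> simple_upto m t (swap_entries r (m + t) w) \<and>
      r \<in> blocked m t (swap_entries r (m + t) w) (w ! t)}" (is "_ \<le> _ + card ?R")
proof -
  \<comment> \<open>Taking \<open>s = t\<close> for a loop lets one witness cover both kinds of
    failure.\<close>
  have "\<exists>s\<le>t. (s = t \<and> w ! t = w ! (m + t)) \<or> (s < t \<and> edge_at m w s = edge_at m w t)"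
    using bad_edge[OF simple bad] by (metis less_imp_le order.refl)
  then obtain s where s: "s \<le> t"
    and s_bad: "(s = t \<and> w ! t = w ! (m + t)) \<or> (s < t \<and> edge_at m w s = edge_at m w t)"
    by auto
  define B where "B = blocked m t w (w ! (m + t))"
  have "r \<in> ?R" if r: "r < 2 * m" "r \<notin> {t, m + t, s, m + s}" "partner m r \<notin> B" for r
  proof -
    have sw: "simple_upto m t (swap_entries r (m + t) w)"
      using r by (intro simple_upto_swap_entries[OF len t simple]) (auto simp: B_def)
    have at_r: "swap_entries r (m + t) w ! r = w ! (m + t)"
      using r t by (simp add: nth_swap_entries len)
    have "edge_at m (swap_entries r (m + t) w) s = edge_at m w s" if "s < t"
      using that r t by (subst edge_at_swap_entries[OF len t]) auto
    with s_bad have "r \<in> blocked m t (swap_entries r (m + t) w) (w ! t)"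
      using r by (auto simp: blocked_def at_r edge_at_def)
    with sw r show ?thesis by simp
  qed
  \<comment> \<open>A position outside \<open>?R\<close> is one of the four excluded ends or, since
    \<open>partner\<close> is an involution, the partner of a blocked position.\<close>
  then have "{..<2 * m} \<subseteq> {t, m + t, s, m + s} \<union> partner m ` B \<union> ?R"
    using partner_partner[of _ m] by (smt (verit) UnCI image_eqI lessThan_iff subsetI)
  then have "card {..<2 * m} \<le> card ({t, m + t, s, m + s} \<union> partner m ` B \<union> ?R)"
    by (intro card_mono) (auto simp: B_def blocked_def)
  also have "\<dots> \<le> card {t, m + t, s, m + s} + card (partner m ` B) + card ?R"
    by (meson add_right_mono card_Un_le order.trans)
  also have "card {t, m + t, s, m + s} \<le> 4"
    by (auto simp: card_insert_if)
  also have "card (partner m ` B) \<le> card B"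
    by (rule card_image_le) (auto simp: B_def blocked_def)
  also have "card B \<le> \<Delta> + \<Delta> * \<Delta>"
    unfolding B_def using t by (intro card_blocked_le[OF len _ cnt]) auto
  finally show ?thesis by simp
qed

text \<open>Double counting of the swaps of position \<open>m + t\<close> with a position \<open>r\<close>: undoing a swap must
  recreate a bad edge at \<open>t\<close>, which leaves few choices for \<open>r\<close>.\<close>

lemma switching_step:
  fixes D :: "'a multiset"
  assumes size: "size D = 2 * m" and t: "t < m" and cnt: "\<And>x. count D x \<le> \<Delta>"
  defines "T \<equiv> \<lambda>t. {w \<in> permutations_of_multiset D. simple_upto m t w}"
  shows "(2 * m - (4 + \<Delta> + \<Delta> * \<Delta>)) * card (T t - T (Suc t)) \<le> (\<Delta> + \<Delta> * \<Delta>) * card (T t)"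
proof -
  have fin: "finite (T t)" for t
    by (simp add: T_def)
  have len: "length w = 2 * m" and mset: "mset w = D" if "w \<in> T t" for w t
    using that size by (auto simp: T_def permutations_of_multiset_def)
  have cnt': "count (mset w) x \<le> \<Delta>" if "w \<in> T t" for w x t
    using mset[OF that] cnt by simp
  define R where "R w = {r. r < 2 * m \<and> simple_upto m t (swap_entries r (m + t) w) \<and>
      r \<in> blocked m t (swap_entries r (m + t) w) (w ! t)}" for w :: "'a list"
  define f where "f = (\<lambda>(w :: 'a list, r). (swap_entries r (m + t) w, r))"
  have mt: "m + t < 2 * m" using t by simp
  \<comment> \<open>The subtraction is truncated, so the bound remains valid, with value 0, when
    \<open>m\<close> is small.\<close>
  have R: "2 * m - (4 + \<Delta> + \<Delta> * \<Delta>) \<le> card (R w)" if "w \<in> T t - T (Suc t)" for w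
  proof -
    have "simple_upto m t w" "\<not> simple_upto m (Suc t) w"
      using that by (auto simp: T_def)
    from card_switchable_ge[OF len[of w t] t cnt'[of w t] this] that show ?thesis
      by (auto simp: R_def)
  qed
  \<comment> \<open>Recording \<open>r\<close> makes the swap reversible, because it is an
    involution.\<close>
  have inj: "inj_on f (Sigma (T t - T (Suc t)) R)"
  proof (rule inj_onI; clarify)
    fix w r w' r' assume *: "f (w, r) = f (w', r')" "w \<in> T t" "w' \<in> T t" "r \<in> R w" "r' \<in> R w'"
    then have r: "r' = r" "r < 2 * m" by (auto simp: f_def R_def)
    have "swap_entries r (m + t) (swap_entries r (m + t) w) =
        swap_entries r (m + t) (swap_entries r (m + t) w')"
      using * r by (simp add: f_def)
    then have "w = w'"
      using r mt len[OF *(2)] len[OF *(3)] by (simp add: swap_entries_swap_entries)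
    then show "w = w' \<and> r = r'" using r by simp
  qed
  have sub: "f ` Sigma (T t - T (Suc t)) R \<subseteq> Sigma (T t) (\<lambda>w. blocked m t w (w ! t))"
  proof (rule image_subsetI)
    fix p assume "p \<in> Sigma (T t - T (Suc t)) R"
    then obtain w r where p: "p = (w, r)" and w: "w \<in> T t" "w \<notin> T (Suc t)" and r: "r \<in> R w"
      by auto
    have lw: "length w = 2 * m" "mset w = D"
      using len[OF w(1)] mset[OF w(1)] by auto
    have "r < 2 * m" "simple_upto m t (swap_entries r (m + t) w)"
      and bl: "r \<in> blocked m t (swap_entries r (m + t) w) (w ! t)"
      using r by (auto simp: R_def)
    then have "swap_entries r (m + t) w \<in> T t"
      using lw mt by (simp add: T_def permutations_of_multiset_def mset_swap_entries)
    moreover have "r \<in> blocked m t (swap_entries r (m + t) w) (swap_entries r (m + t) w ! t)"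
    \<comment> \<open>For \<open>r = t\<close> the position is blocked by its own entry; otherwise
      the swap leaves the entry at \<open>t\<close> alone.\<close>
    proof (cases "r = t")
      case True
      then show ?thesis using \<open>r < 2 * m\<close> by (simp add: blocked_def)
    next
      case False
      then show ?thesis using bl \<open>r < 2 * m\<close> lw mt t by (simp add: nth_swap_entries)
    qed
    ultimately show "f p \<in> Sigma (T t) (\<lambda>w. blocked m t w (w ! t))"
      by (simp add: f_def p)
  qed
  have "(2 * m - (4 + \<Delta> + \<Delta> * \<Delta>)) * card (T t - T (Suc t)) \<le> (\<Sum>w\<in>T t - T (Suc t). card (R w))"
    using sum_mono[of "T t - T (Suc t)" "\<lambda>_. 2 * m - (4 + \<Delta> + \<Delta> * \<Delta>)" "\<lambda>w. card (R w)"] R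
    by (simp add: mult.commute)
  also have "\<dots> = card (Sigma (T t - T (Suc t)) R)"
    by (subst card_SigmaI) (auto simp: fin R_def)
  also have "\<dots> \<le> card (Sigma (T t) (\<lambda>w. blocked m t w (w ! t)))"
    by (rule card_inj_on_le[OF inj sub]) (auto simp: fin blocked_def)
  also have "\<dots> = (\<Sum>w\<in>T t. card (blocked m t w (w ! t)))"
    by (subst card_SigmaI) (auto simp: fin blocked_def)
  also have "\<dots> \<le> (\<Sum>w\<in>T t. \<Delta> + \<Delta> * \<Delta>)"
    using t by (intro sum_mono card_blocked_le len cnt') auto
  finally show ?thesis by (simp add: mult.commute)
qed

text \<open>Each of the \<open>m\<close> stages loses at most a fraction \<open>q\<close> of the
  arrangements, so at least \<open>(1 - q) ^ m\<close> of them survive, and this is at least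
  \<open>exp (- 2 * q * m)\<close>.\<close>

lemma card_simple_ge:
  fixes D :: "'a multiset"
  assumes size: "size D = 2 * m" and cnt: "\<And>x. count D x \<le> \<Delta>"
    and \<Delta>: "1 \<le> \<Delta>" "6 * \<Delta>\<^sup>2 \<le> m"
  shows "exp (- 4 * real \<Delta> ^ 2) * real (card (permutations_of_multiset D)) \<le>
    real (card {w \<in> permutations_of_multiset D. simple_upto m m w})"
proof -
  define T where "T t = {w \<in> permutations_of_multiset D. simple_upto m t w}" for t
  define q where "q = 2 * (real \<Delta>)\<^sup>2 / real m"
  have le: "\<Delta> \<le> \<Delta> ^ 2" "1 \<le> \<Delta> ^ 2"
    using \<Delta>(1) by (simp_all add: power2_eq_square)
  then have m: "0 < m" using \<Delta>(2) by simp
  have m': "6 * (real \<Delta>)\<^sup>2 \<le> real m"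
    using \<Delta>(2) by (metis of_nat_le_iff of_nat_mult of_nat_numeral of_nat_power)
  then have q: "0 \<le> q" "q \<le> 1 / 2"
    using m by (auto simp: q_def field_simps)
  have step: "(1 - q) * real (card (T t)) \<le> real (card (T (Suc t)))" if "t < m" for t
  proof -
    have sub: "T (Suc t) \<subseteq> T t"
      by (auto simp: T_def simple_upto_def inj_on_def)
    have fin: "finite (T t)" for t by (simp add: T_def)
    \<comment> \<open>Since \<Delta> is at least 1, the subtracted term is at most
      \<open>6 * \<Delta>\<^sup>2\<close>, hence at most \<open>m\<close>; this is the source of the
      constant 6.\<close>
    have "m \<le> 2 * m - (4 + \<Delta> + \<Delta> * \<Delta>)"
      using \<Delta>(2) le unfolding power2_eq_square by linarith
    then have "m * card (T t - T (Suc t)) \<le> (2 * m - (4 + \<Delta> + \<Delta> * \<Delta>)) * card (T t - T (Suc t))"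
      by (rule mult_right_mono) simp
    also have "\<dots> \<le> (\<Delta> + \<Delta> * \<Delta>) * card (T t)"
      unfolding T_def by (rule switching_step[OF size that cnt])
    also have "\<dots> \<le> (2 * \<Delta> ^ 2) * card (T t)"
      using le by (intro mult_right_mono) (simp_all add: power2_eq_square)
    finally have "real (m * card (T t - T (Suc t))) \<le> real ((2 * \<Delta> ^ 2) * card (T t))"
      by (simp only: of_nat_le_iff)
    then have "real (card (T t - T (Suc t))) \<le> q * real (card (T t))"
      using m by (simp add: q_def field_simps)
    moreover have "real (card (T t - T (Suc t))) = real (card (T t)) - real (card (T (Suc t)))"
      using card_Diff_subset[OF fin sub] card_mono[OF fin sub] by (simp add: of_nat_diff)
    ultimately show ?thesis by (simp add: algebra_simps)
  qed
  have "(1 - q) ^ t * real (card (T 0)) \<le> real (card (T t))" if "t \<le> m" for t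
    using that
  proof (induction t)
    case (Suc t)
    have "(1 - q) ^ Suc t * real (card (T 0)) = (1 - q) * ((1 - q) ^ t * real (card (T 0)))"
      by simp
    also have "\<dots> \<le> (1 - q) * real (card (T t))"
      using Suc q by (intro mult_left_mono) auto
    also have "\<dots> \<le> real (card (T (Suc t)))"
      using Suc by (intro step) auto
    finally show ?case .
  qed simp
  from this[of m] have main: "(1 - q) ^ m * real (card (T 0)) \<le> real (card (T m))" by simp
  \<comment> \<open>With \<open>q\<close> at most 1/2, the standard bound
    \<open>- q - 2 * q\<^sup>2\<close> for \<open>ln (1 - q)\<close> is at least
    \<open>- 2 * q\<close>.\<close>
  have "q * q \<le> q * (1 / 2)"
    using q by (intro mult_left_mono) auto
  then have "- 2 * q \<le> - q - 2 * q\<^sup>2"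
    by (simp add: power2_eq_square)
  also have "\<dots> \<le> ln (1 - q)"
    using q by (rule ln_one_minus_pos_lower_bound)
  finally have "exp (- 2 * q) \<le> 1 - q"
    using q by (simp add: ln_ge_iff)
  then have "exp (- 2 * q) ^ m \<le> (1 - q) ^ m"
    by (intro power_mono) auto
  also have "exp (- 2 * q) ^ m = exp (- 4 * real \<Delta> ^ 2)"
    using m by (simp add: q_def flip: exp_of_nat_mult)
  finally have "exp (- 4 * real \<Delta> ^ 2) * real (card (T 0)) \<le> (1 - q) ^ m * real (card (T 0))"
    by (rule mult_right_mono) simp
  also note main
  also have "T 0 = permutations_of_multiset D"
    by (simp add: T_def simple_upto_def)
  finally show ?thesis by (simp add: T_def)
qed

section \<open>Counting graphs and Eulerian orientations\<close>

lemma finite_graphs_with_degrees: "finite (graphs_with_degrees n d)"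
proof -
  have "graphs_with_degrees n d \<subseteq> Pow (nsets {1..n} 2)"
    by (auto simp: graphs_with_degrees_def)
  then show ?thesis
    by (rule finite_subset) (simp add: finite_imp_finite_nsets)
qed

text \<open>Distinct pairs give distinct edges, and without loops no pair contains \<open>v\<close>
  twice, so incident edges correspond to occurrences of \<open>v\<close>.\<close>

lemma vertex_degree_edges:
  assumes len: "length w = 2 * m" and simple: "simple_upto m m w"
  shows "vertex_degree (edge_at m w ` {..<m}) v = count (mset w) v"
proof -
  let ?L = "{s. s < m \<and> w ! s = v}" and ?R = "{s. s < m \<and> w ! (m + s) = v}"
  have inj: "inj_on (edge_at m w) {..<m}" and proper: "\<And>s. s < m \<Longrightarrow> w ! s \<noteq> w ! (m + s)"
    using simple by (auto simp: simple_upto_def)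
  have "{e \<in> edge_at m w ` {..<m}. v \<in> e} = edge_at m w ` (?L \<union> ?R)"
    by (auto simp: edge_at_def)
  moreover have "inj_on (edge_at m w) (?L \<union> ?R)"
    by (rule inj_on_subset[OF inj]) auto
  ultimately have "vertex_degree (edge_at m w ` {..<m}) v = card (?L \<union> ?R)"
    by (simp add: vertex_degree_def card_image)
  also have "\<dots> = card ?L + card ?R"
    by (rule card_Un_disjoint) (auto dest: proper)
  also have "card ?R = card ((+) m ` ?R)"
    by (simp add: card_image)
  also have "card ?L + card ((+) m ` ?R) = card (?L \<union> (+) m ` ?R)"
    by (rule card_Un_disjoint[symmetric]) auto
  also have "?L \<union> (+) m ` ?R = {r. r < length w \<and> w ! r = v}"
  proof safe
    fix r assume r: "r < length w" "r \<notin> (+) m ` {s. s < m \<and> w ! (m + s) = w ! r}"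
    show "r < m"
    proof (rule ccontr)
      assume "\<not> r < m"
      then have "r = m + (r - m)" "r - m < m" using r(1) len by auto
      then show False using r(2) by (metis (mono_tags, lifting) imageI mem_Collect_eq)
    qed
  qed (auto simp: len)
  finally show ?thesis by (simp add: card_positions)
qed

text \<open>A simple arrangement is recovered from its graph, the order of the \<open>m\<close>
  edges, and one bit per edge telling which end comes first.\<close>

lemma card_simple_le:
  fixes D :: "nat multiset"
  assumes size: "size D = 2 * m" and cnt: "\<And>i. count D i = (if i \<in> {1..n} then d i else 0)"
  shows "card {w \<in> permutations_of_multiset D. simple_upto m m w} \<le>
    card (graphs_with_degrees n d) * (fact m * 2 ^ m)"
proof -
  let ?T = "{w \<in> permutations_of_multiset D. simple_upto m m w}"
  \<comment> \<open>Fixing the number of edges gives every graph exactly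
    \<open>fact m * 2 ^ m\<close> codes; dropping the restriction at the end only enlarges the
    bound.\<close>
  let ?\<G> = "{G \<in> graphs_with_degrees n d. finite G \<and> card G = m}"
  let ?S = "\<lambda>G. permutations_of_set G \<times> {bs :: bool list. length bs = m}"
  have bits: "finite {bs :: bool list. length bs = m}" "card {bs :: bool list. length bs = m} = 2 ^ m"
    using finite_lists_length_eq[of "UNIV :: bool set" m] card_lists_length_eq[of "UNIV :: bool set" m]
    by simp_all
  define f where "f w = (edge_at m w ` {..<m}, map (edge_at m w) [0..<m],
      map (\<lambda>s. w ! s < w ! (m + s)) [0..<m])" for w :: "nat list"
  have T: "length w = 2 * m" "mset w = D" "simple_upto m m w" if "w \<in> ?T" for w
    using that size by (auto simp: permutations_of_multiset_def)
  have inj: "inj_on f ?T"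
  proof (rule inj_onI)
    fix w w' assume w: "w \<in> ?T" "w' \<in> ?T" and eq: "f w = f w'"
    have s: "w ! s = w' ! s \<and> w ! (m + s) = w' ! (m + s)" if "s < m" for s
    proof -
      have "edge_at m w s = edge_at m w' s" "(w ! s < w ! (m + s)) = (w' ! s < w' ! (m + s))"
        using eq that by (auto simp: f_def)
      moreover have "w ! s \<noteq> w ! (m + s)"
        using T(3)[OF w(1)] that by (simp add: simple_upto_def)
      ultimately show ?thesis
        by (auto simp: edge_at_def doubleton_eq_iff)
    qed
    show "w = w'"
    proof (rule nth_equalityI)
      fix i assume "i < length w"
      then have "i < m \<or> (i = m + (i - m) \<and> i - m < m)" using T(1)[OF w(1)] by auto
      then show "w ! i = w' ! i" using s[of i] s[of "i - m"] by auto
    qed (use T(1) w in auto)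
  qed
  have sub: "f ` ?T \<subseteq> Sigma ?\<G> ?S"
  proof (rule image_subsetI)
    fix w assume w: "w \<in> ?T"
    have "edge_at m w s \<in> nsets {1..n} 2" if "s < m" for s
    proof -
      have "w ! i \<in> {1..n}" if "i < 2 * m" for i
      proof -
        have "w ! i \<in># D" using T(1,2)[OF w] that by (metis nth_mem_mset)
        then show ?thesis using cnt[of "w ! i"] by (metis not_in_iff)
      qed
      from this[of s] this[of "m + s"] show ?thesis
        using T(3)[OF w] that by (simp add: edge_at_def simple_upto_def)
    qed
    moreover have "vertex_degree (edge_at m w ` {..<m}) i = d i" if "i \<in> {1..n}" for i
      using vertex_degree_edges[OF T(1,3)[OF w], of i] T(2)[OF w] cnt[of i] that by (simp only: if_True)
    ultimately have "edge_at m w ` {..<m} \<in> graphs_with_degrees n d"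
      unfolding graphs_with_degrees_def by blast
    moreover have "map (edge_at m w) [0..<m] \<in> permutations_of_set (edge_at m w ` {..<m})"
      using T(3)[OF w]
      by (intro permutations_of_setI)
        (auto simp: distinct_map simple_upto_def atLeast0LessThan)
    moreover have "card (edge_at m w ` {..<m}) = m"
      using T(3)[OF w] by (simp add: simple_upto_def card_image)
    ultimately show "f w \<in> Sigma ?\<G> ?S"
      by (auto simp: f_def)
  qed
  have fin: "finite ?\<G>"
    by (simp add: finite_graphs_with_degrees)
  have fin': "finite (?S G)" for G
    by (simp add: bits)
  have fin_Sigma: "finite (Sigma ?\<G> ?S)"
    using fin fin' by (rule finite_SigmaI)
  have "card ?T \<le> card (Sigma ?\<G> ?S)"
    by (rule card_inj_on_le[OF inj sub fin_Sigma])
  also have "\<dots> = (\<Sum>G\<in>?\<G>. card (?S G))"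
    by (rule card_SigmaI) (rule fin, use fin' in blast)
  also have "\<dots> = (\<Sum>G\<in>?\<G>. fact m * 2 ^ m)"
    by (intro sum.cong refl) (simp add: card_cartesian_product bits)
  also have "\<dots> \<le> card (graphs_with_degrees n d) * (fact m * 2 ^ m)"
    by (simp add: card_mono[OF finite_graphs_with_degrees])
  finally show ?thesis .
qed

section \<open>Digraphs with prescribed degrees\<close>

lemma outdegree_eq: "outdegree A v = card {a \<in> A. fst a = v}"
proof -
  have "{a \<in> A. fst a = v} = Pair v ` {w. (v, w) \<in> A}" by auto
  then show ?thesis by (simp add: outdegree_def card_image inj_on_def)
qed

lemma indegree_eq: "indegree A v = card {a \<in> A. snd a = v}"
proof -
  have "{a \<in> A. snd a = v} = (\<lambda>u. (u, v)) ` {u. (u, v) \<in> A}" by auto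
  then show ?thesis by (simp add: indegree_def card_image inj_on_def)
qed

definition digraphs_with_degrees :: "nat \<Rightarrow> (nat \<Rightarrow> nat) \<Rightarrow> (nat \<times> nat) set set" where
  "digraphs_with_degrees n k = {A. A \<subseteq> {1..n} \<times> {1..n} \<and>
     (\<forall>v\<in>{1..n}. outdegree A v = k v \<and> indegree A v = k v)}"

lemma finite_digraphs_with_degrees: "finite (digraphs_with_degrees n k)"
  by (rule finite_subset[of _ "Pow ({1..n} \<times> {1..n})"]) (auto simp: digraphs_with_degrees_def)

lemma image_mset_digraph:
  assumes A: "A \<in> digraphs_with_degrees n k"
    and cnt: "\<And>i. count K i = (if i \<in> {1..n} then k i else 0)"
  shows "image_mset fst (mset_set A) = K" "image_mset snd (mset_set A) = K"
proof -
  have sub: "A \<subseteq> {1..n} \<times> {1..n}"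
    using A by (simp add: digraphs_with_degrees_def)
  then have fin: "finite A" by (rule finite_subset) simp
  have *: "count (image_mset f (mset_set A)) i = card {a \<in> A. f a = i}" for f :: "_ \<Rightarrow> nat" and i
    using fin by (simp add: count_image_mset' eq_commute[of i])
  have empty: "{a \<in> A. fst a = i} = {}" "{a \<in> A. snd a = i} = {}" if "i \<notin> {1..n}" for i
    using subsetD[OF sub] that by (fastforce simp del: atLeastAtMost_iff)+
  have deg: "card {a \<in> A. fst a = i} = count K i" "card {a \<in> A. snd a = i} = count K i" for i
  proof -
    have "card {a \<in> A. fst a = i} = count K i \<and> card {a \<in> A. snd a = i} = count K i"
    proof (cases "i \<in> {1..n}")
      case True
      then show ?thesis
        using A unfolding cnt digraphs_with_degrees_def outdegree_eq indegree_eq by simp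
    next
      case False
      then show ?thesis
        unfolding empty[OF False] cnt by (simp only: if_False card.empty simp_thms)
    qed
    then show "card {a \<in> A. fst a = i} = count K i" "card {a \<in> A. snd a = i} = count K i"
      by blast+
  qed
  then show "image_mset fst (mset_set A) = K"
    by (intro multiset_eqI) (simp add: *)
  from deg show "image_mset snd (mset_set A) = K"
    by (intro multiset_eqI) (simp add: *)
qed

text \<open>Each ordering of the arcs yields a list of tails and a list of heads, both arrangements
  of \<open>K\<close>. Zipping them recovers the ordering and hence the digraph, and each digraph
  has \<open>fact (size K)\<close> orderings.\<close>

lemma card_digraphs_le:
  assumes cnt: "\<And>i. count K i = (if i \<in> {1..n} then k i else 0)"
  shows "card (digraphs_with_degrees n k) * fact (size K) \<le> card (permutations_of_multiset K) ^ 2"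
proof -
  let ?S = "Sigma (digraphs_with_degrees n k) permutations_of_set"
  let ?P = "permutations_of_multiset K"
  define f where "f = (\<lambda>(A :: (nat \<times> nat) set, xs :: (nat \<times> nat) list). (map fst xs, map snd xs))"
  have fin: "finite A" if "A \<in> digraphs_with_degrees n k" for A
    using that by (intro finite_subset[of A "{1..n} \<times> {1..n}"]) (auto simp: digraphs_with_degrees_def)
  have card_A: "card A = size K" if "A \<in> digraphs_with_degrees n k" for A
    using image_mset_digraph(1)[OF that cnt] by (metis size_image_mset size_mset_set)
  have "inj_on f ?S"
  proof (rule inj_onI; clarify)
    fix A xs B ys assume *: "f (A, xs) = f (B, ys)" "xs \<in> permutations_of_set A" "ys \<in> permutations_of_set B"
    then have "xs = ys" by (metis (no_types, lifting) case_prod_conv f_def prod.inject zip_map_fst_snd)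
    then show "A = B \<and> xs = ys" using * by (auto simp: permutations_of_set_def)
  qed
  moreover have "f ` ?S \<subseteq> ?P \<times> ?P"
  proof (rule image_subsetI)
    fix p assume "p \<in> ?S"
    then obtain A xs where p: "p = (A, xs)" and A: "A \<in> digraphs_with_degrees n k"
      and xs: "xs \<in> permutations_of_set A"
      by auto
    have "mset xs = mset_set A"
      using xs by (auto simp: permutations_of_set_def mset_set_set)
    then show "f p \<in> ?P \<times> ?P"
      using image_mset_digraph[OF A cnt] by (simp add: f_def p permutations_of_multiset_def)
  qed
  ultimately have "card ?S \<le> card (?P \<times> ?P)"
    by (rule card_inj_on_le) simp
  also have "card ?S = (\<Sum>A\<in>digraphs_with_degrees n k. card (permutations_of_set A))"
    by (rule card_SigmaI) (auto simp: finite_digraphs_with_degrees)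
  also have "\<dots> = (\<Sum>A\<in>digraphs_with_degrees n k. fact (size K))"
    by (intro sum.cong refl) (simp add: fin card_A)
  finally show ?thesis
    by (simp only: sum_constant card_cartesian_product power2_eq_square of_nat_id)
qed

section \<open>Orientations as digraphs\<close>

lemma orientation_subset:
  assumes "G \<subseteq> nsets {1..n} 2" "orientation_of G A"
  shows "A \<subseteq> {1..n} \<times> {1..n}" "\<And>v. (v, v) \<notin> A"
proof -
  have G: "(\<lambda>(u, v). {u, v}) ` A = G"
    using assms(2) by (simp add: orientation_of_def bij_betw_def)
  have *: "u \<in> {1..n} \<and> v \<in> {1..n} \<and> u \<noteq> v" if "(u, v) \<in> A" for u v
  proof -
    have "(\<lambda>(u, v). {u, v}) (u, v) \<in> nsets {1..n} 2"
      using imageI[OF that, of "\<lambda>(u, v). {u, v}"] assms(1) unfolding G by (rule subsetD[rotated])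
    then have "{u, v} \<in> nsets {1..n} 2" by (simp only: case_prod_conv)
    then show ?thesis by (simp only: doubleton_in_nsets_2 simp_thms)
  qed
  show "A \<subseteq> {1..n} \<times> {1..n}" by (rule subrelI) (rule SigmaI; use * in blast)
  show "(v, v) \<notin> A" for v using *[of v v] by blast
qed

text \<open>Each edge at \<open>v\<close> comes from exactly one arc, which has \<open>v\<close> as
  its tail or its head but, being no loop, not both.\<close>

lemma vertex_degree_orientation:
  assumes "G \<subseteq> nsets {1..n} 2" "orientation_of G A"
  shows "vertex_degree G v = outdegree A v + indegree A v"
proof -
  let ?h = "\<lambda>(u, v). {u, v :: nat}"
  have fin: "finite A"
    using orientation_subset(1)[OF assms] by (rule finite_subset) simp
  have inj: "inj_on ?h A" and G: "G = ?h ` A"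
    using assms(2) by (auto simp: orientation_of_def bij_betw_def)
  have "{e \<in> G. v \<in> e} = ?h ` ({a \<in> A. fst a = v} \<union> {a \<in> A. snd a = v})"
    unfolding G by fastforce
  moreover have "inj_on ?h ({a \<in> A. fst a = v} \<union> {a \<in> A. snd a = v})"
    by (rule inj_on_subset[OF inj]) blast
  ultimately have "vertex_degree G v = card ({a \<in> A. fst a = v} \<union> {a \<in> A. snd a = v})"
    by (simp only: vertex_degree_def card_image)
  also have "\<dots> = card {a \<in> A. fst a = v} + card {a \<in> A. snd a = v}"
    using orientation_subset(2)[OF assms] fin by (intro card_Un_disjoint) auto
  finally show ?thesis by (simp add: outdegree_eq indegree_eq)
qed

text \<open>Forgetting directions recovers the graph, so different graphs have disjoint sets of
  orientations; balance splits each degree in half.\<close>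

lemma sum_EO_le:
  "(\<Sum>G\<in>graphs_with_degrees n d. EO G) \<le> card (digraphs_with_degrees n (\<lambda>i. d i div 2))"
proof -
  define Q where "Q G = {A. orientation_of G A \<and> (\<forall>v. indegree A v = outdegree A v)}" for G
  have sub: "Q G \<subseteq> digraphs_with_degrees n (\<lambda>i. d i div 2)" if "G \<in> graphs_with_degrees n d" for G
  proof
    fix A assume "A \<in> Q G"
    then have A: "orientation_of G A" "\<And>v. indegree A v = outdegree A v"
      by (auto simp: Q_def)
    have G: "G \<subseteq> nsets {1..n} 2" "\<And>i. i \<in> {1..n} \<Longrightarrow> vertex_degree G i = d i"
      using that by (auto simp: graphs_with_degrees_def)
    have "outdegree A v = d v div 2" if "v \<in> {1..n}" for v
      using G(2)[OF that] vertex_degree_orientation[OF G(1) A(1), of v] A(2)[of v] by simp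
    then show "A \<in> digraphs_with_degrees n (\<lambda>i. d i div 2)"
      using orientation_subset(1)[OF G(1) A(1)] A(2) by (auto simp: digraphs_with_degrees_def)
  qed
  have img: "(\<lambda>(u, v). {u, v}) ` A = G" if "A \<in> Q G" for A G
    using that by (simp add: Q_def orientation_of_def bij_betw_def)
  have "(\<Sum>G\<in>graphs_with_degrees n d. EO G) = (\<Sum>G\<in>graphs_with_degrees n d. card (Q G))"
    by (simp add: EO_def Q_def)
  also have "\<dots> = card (\<Union>G\<in>graphs_with_degrees n d. Q G)"
  proof (rule card_UN_disjoint[symmetric])
    show "\<forall>G\<in>graphs_with_degrees n d. finite (Q G)"
      by (intro ballI finite_subset[OF sub finite_digraphs_with_degrees])
    show "\<forall>G\<in>graphs_with_degrees n d. \<forall>H\<in>graphs_with_degrees n d. G \<noteq> H \<longrightarrow> Q G \<inter> Q H = {}"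
      using img by (metis disjoint_iff)
  qed (rule finite_graphs_with_degrees)
  also have "\<dots> \<le> card (digraphs_with_degrees n (\<lambda>i. d i div 2))"
    by (rule card_mono[OF finite_digraphs_with_degrees UN_least[OF sub]])
  finally show ?thesis .
qed

section \<open>The expected number of Eulerian orientations\<close>

text \<open>The squared form of \<open>fact_square_le\<close>, free of roots and so open to
  induction. The step rests on \<open>4 * m * (m + 1) \<le> (2 * m + 1)\<^sup>2\<close>.\<close>

lemma central_binomial_fact:
  assumes "0 < m"
  shows "16 ^ m * fact m ^ 4 \<le> 4 * real m * (fact (2 * m))\<^sup>2"
  using assms
proof (induction m rule: nat_induct_non_zero)
  case (Suc m)
  define F where "F = (fact (2 * m) :: real)"
  have F: "fact (2 * Suc m) = (2 * real m + 2) * (2 * real m + 1) * F"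
    by (simp add: F_def algebra_simps)
  have "16 ^ Suc m * fact (Suc m) ^ 4 = 16 * (real m + 1) ^ 4 * (16 ^ m * fact m ^ 4)"
    by (simp add: power_mult_distrib add.commute)
  also have "\<dots> \<le> 16 * (real m + 1) ^ 4 * (4 * real m * F\<^sup>2)"
    using Suc by (intro mult_left_mono) (auto simp: F_def)
  also have "\<dots> = 16 * (real m + 1) ^ 3 * F\<^sup>2 * ((real m + 1) * (4 * real m))"
    by algebra
  also have "\<dots> \<le> 16 * (real m + 1) ^ 3 * F\<^sup>2 * (2 * real m + 1)\<^sup>2"
    by (intro mult_left_mono mult_nonneg_nonneg) (auto simp: power2_eq_square algebra_simps)
  also have "\<dots> = 4 * real (Suc m) * (fact (2 * Suc m))\<^sup>2"
    unfolding F of_nat_Suc by algebra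
  finally show ?case .
qed simp

lemma fact_square_le:
  assumes "0 < m"
  shows "4 ^ m * (fact m)\<^sup>2 \<le> 2 * sqrt (real m) * fact (2 * m)"
proof (rule power2_le_imp_le)
  have "(4 ^ m * (fact m)\<^sup>2)\<^sup>2 = (16 ^ m * fact m ^ 4 :: real)"
    by (simp add: power_mult_distrib flip: power_mult) (simp add: power_mult mult.commute[of m])
  then show "(4 ^ m * (fact m)\<^sup>2)\<^sup>2 \<le> (2 * sqrt (real m) * fact (2 * m))\<^sup>2"
    using central_binomial_fact[OF assms] by (simp add: power_mult_distrib)
qed simp

text \<open>Taken with the degrees for the ends of the pairs, and with half the degrees for the
  tails and for the heads of arcs.\<close>

definition degree_mset :: "nat \<Rightarrow> (nat \<Rightarrow> nat) \<Rightarrow> nat multiset" where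
  "degree_mset n k = (\<Sum>i=1..n. replicate_mset (k i) i)"

lemma count_degree_mset: "count (degree_mset n k) i = (if i \<in> {1..n} then k i else 0)"
  by (simp add: degree_mset_def count_sum)

lemma size_degree_mset: "size (degree_mset n k) = (\<Sum>i=1..n. k i)"
  by (simp add: degree_mset_def)

lemma card_permutations_degree_mset:
  "card (permutations_of_multiset (degree_mset n k)) * (\<Prod>i=1..n. fact (k i)) = fact (\<Sum>i=1..n. k i)"
proof -
  let ?K = "degree_mset n k"
  have sub: "set_mset ?K \<subseteq> {1..n}"
    by (auto simp: count_degree_mset simp flip: count_greater_zero_iff split: if_splits)
  have "(\<Prod>i=1..n. fact (k i)) = (\<Prod>i=1..n. fact (count ?K i) :: nat)"
    by (simp add: count_degree_mset)
  \<comment> \<open>Vertices of multiplicity 0 contribute the factor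
    \<open>fact 0 = 1\<close>.\<close>
  also have "\<dots> = (\<Prod>i\<in>set_mset ?K. fact (count ?K i))"
    using sub by (intro prod.mono_neutral_right) (auto simp: not_in_iff)
  finally show ?thesis
    using card_permutations_of_multiset_aux[of ?K] by (simp add: size_degree_mset)
qed

section \<open>The mean of \<open>EO\<close> against \<open>rho_hat\<close>\<close>

lemma exp_rho_hat:
  assumes "0 < n" and "\<And>i. i \<in> {1..n} \<Longrightarrow> even (d i)"
  shows "exp (real n * rho_hat n d) =
    (\<Prod>i=1..n. real (d i choose (d i div 2))) / 2 ^ (\<Sum>i=1..n. d i div 2)"
proof -
  have "exp (real n * rho_hat n d) =
      exp (\<Sum>i=1..n. ln (real (d i choose (d i div 2))) - real (d i) / 2 * ln 2)"
    using assms(1) by (simp add: rho_hat_def)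
  also have "\<dots> = (\<Prod>i=1..n. exp (ln (real (d i choose (d i div 2))) - real (d i) / 2 * ln 2))"
    by (simp add: exp_sum)
  also have "\<dots> = (\<Prod>i=1..n. real (d i choose (d i div 2)) / 2 ^ (d i div 2))"
  proof (intro prod.cong refl)
    fix i assume "i \<in> {1..n}"
    then have "real (d i) / 2 = real (d i div 2)"
      using assms(2) by (simp add: real_of_nat_div)
    moreover have "exp (real (d i div 2) * ln 2) = 2 ^ (d i div 2)"
      by (simp add: exp_of_nat_mult)
    ultimately show "exp (ln (real (d i choose (d i div 2))) - real (d i) / 2 * ln 2) =
        real (d i choose (d i div 2)) / 2 ^ (d i div 2)"
      by (simp only: exp_diff) simp
  qed
  finally show ?thesis
    by (simp add: prod_dividef power_sum)
qed

text \<open>Excludes graphs with \<open>EO G = 0\<close> from the event, since \<open>ln 0 = 0\<close> makes \<open>rho n G\<close> zero then.\<close>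

lemma rho_hat_nonneg:
  assumes "\<And>i. i \<in> {1..n} \<Longrightarrow> 0 < d i \<and> even (d i)"
  shows "0 \<le> rho_hat n d"
proof -
  have "0 \<le> ln (real (d i choose (d i div 2))) - real (d i) / 2 * ln 2" if "i \<in> {1..n}" for i
  proof -
    define k where "k = d i div 2"
    have k: "d i = 2 * k" "0 < k"
      using assms[OF that] by (auto simp: k_def)
    \<comment> \<open>This turns the bound \<open>4 ^ k / (2 * k)\<close> for the central binomial
      coefficient into the needed \<open>2 ^ k\<close>.\<close>
    have "2 * real k \<le> 2 ^ k"
      using k(2) by (induction k rule: nat_induct_non_zero) auto
    then have "2 ^ k * (2 * real k) \<le> 2 ^ k * 2 ^ k"
      by (rule mult_left_mono) simp
    also have "\<dots> = 4 ^ k"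
      by (simp flip: power_mult_distrib)
    finally have "2 ^ k \<le> 4 ^ k / (2 * real k)"
      using k(2) by (simp add: field_simps)
    also have "\<dots> \<le> real ((2 * k) choose k)"
      using k(2) by (rule central_binomial_lower_bound)
    finally have "ln (2 ^ k) \<le> ln (real ((2 * k) choose k))"
      by (subst ln_le_cancel_iff) auto
    then show ?thesis by (simp add: k ln_realpow)
  qed
  then show ?thesis
    unfolding rho_hat_def by (intro mult_nonneg_nonneg sum_nonneg) simp_all
qed

text \<open>The total of \<open>EO\<close> is at most \<open>fact m / pk\<^sup>2\<close>, and the
  number of graphs is at least \<open>fact (2 * m) / (E * fact m * 2 ^ m * pd)\<close>. Their
  quotient is \<open>exp (n * rho_hat)\<close> times
  \<open>E * 4 ^ m * (fact m)\<^sup>2 / fact (2 * m)\<close>, which is at most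
  \<open>E * 2 * sqrt m\<close>.\<close>

lemma sum_EO_le_card_graphs:
  assumes n: "0 < n" and d: "\<And>i. i \<in> {1..n} \<Longrightarrow> even (d i) \<and> d i \<le> \<Delta>"
    and \<Delta>: "1 \<le> \<Delta>" "12 * \<Delta>\<^sup>2 \<le> (\<Sum>i=1..n. d i)"
  shows "real (\<Sum>G\<in>graphs_with_degrees n d. EO G) \<le>
    real (card (graphs_with_degrees n d)) * (sqrt (real n) * exp (6 * (real \<Delta>)\<^sup>2) * exp (real n * rho_hat n d))"
proof -
  define k where "k i = d i div 2" for i
  define m where "m = (\<Sum>i=1..n. k i)"
  define PD where "PD = real (card (permutations_of_multiset (degree_mset n d)))"
  define PK where "PK = real (card (permutations_of_multiset (degree_mset n k)))"
  define pd where "pd = (\<Prod>i=1..n. fact (d i) :: real)"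
  define pk where "pk = (\<Prod>i=1..n. fact (k i) :: real)"
  define SE where "SE = real (\<Sum>G\<in>graphs_with_degrees n d. EO G)"
  define N where "N = real (card (graphs_with_degrees n d))"
  define E where "E = exp (4 * (real \<Delta>)\<^sup>2)"
  have dk: "d i = 2 * k i" if "i \<in> {1..n}" for i
    using d[OF that] by (simp add: k_def)
  have sum_d: "(\<Sum>i=1..n. d i) = 2 * m"
    using dk by (simp add: m_def sum_distrib_left)
  have size_d: "size (degree_mset n d) = 2 * m"
    unfolding size_degree_mset by (rule sum_d)
  have m2: "6 * \<Delta>\<^sup>2 \<le> m"
    using \<Delta>(2) unfolding sum_d by simp
  have "0 < \<Delta>\<^sup>2"
    using \<Delta>(1) by simp
  with m2 have m: "0 < m" "6 * \<Delta>\<^sup>2 \<le> m"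
    by linarith+
  have pos: "0 < pd" "0 < pk" "0 < E"
    by (auto simp: pd_def pk_def E_def intro!: prod_pos)
  have PD: "PD * pd = fact (2 * m)"
    using arg_cong[OF card_permutations_degree_mset[of n d, unfolded sum_d], of real]
    by (simp add: PD_def pd_def)
  have PK: "PK * pk = fact m"
    using arg_cong[OF card_permutations_degree_mset[of n k, folded m_def], of real]
    by (simp add: PK_def pk_def)
  have "count (degree_mset n d) x \<le> \<Delta>" for x
    using d[of x] by (simp add: count_degree_mset)
  then have "exp (- 4 * (real \<Delta>)\<^sup>2) * PD \<le>
      real (card {w \<in> permutations_of_multiset (degree_mset n d). simple_upto m m w})"
    unfolding PD_def using \<Delta>(1) m(2) by (intro card_simple_ge) (simp_all add: size_d)
  also have "\<dots> \<le> real (card (graphs_with_degrees n d) * (fact m * 2 ^ m))"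
    by (intro of_nat_mono card_simple_le) (simp_all add: size_d count_degree_mset)
  finally have "PD / E \<le> N * (fact m * 2 ^ m)"
    by (simp add: E_def N_def exp_minus field_simps)
  then have "PD * pd \<le> E * N * (fact m * 2 ^ m) * pd"
    using pos by (intro mult_right_mono) (auto simp: field_simps)
  then have lower: "fact (2 * m) \<le> E * N * (fact m * 2 ^ m) * pd"
    by (simp add: PD)
  have "real (card (digraphs_with_degrees n k) * fact m) \<le> real (card (permutations_of_multiset (degree_mset n k)) ^ 2)"
    using card_digraphs_le[of "degree_mset n k" n k, OF count_degree_mset]
    by (intro of_nat_mono) (simp add: size_degree_mset m_def)
  then have "real (card (digraphs_with_degrees n k)) * fact m \<le> PK\<^sup>2"
    by (simp add: PK_def)
  moreover have "SE \<le> real (card (digraphs_with_degrees n k))"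
    unfolding SE_def using sum_EO_le[of n d] by (intro of_nat_mono) (simp add: k_def[abs_def])
  ultimately have "SE * fact m \<le> PK\<^sup>2"
    by (meson fact_ge_zero mult_right_mono order.trans)
  then have "SE * fact m * pk\<^sup>2 \<le> PK\<^sup>2 * pk\<^sup>2"
    by (rule mult_right_mono) simp
  also have "\<dots> = fact m * fact m"
    by (simp only: power_mult_distrib[symmetric] PK) (simp only: power2_eq_square)
  finally have "fact m * (SE * pk\<^sup>2) \<le> fact m * fact m"
    by (simp only: mult_ac)
  then have upper: "SE * pk\<^sup>2 \<le> fact m"
    by (rule mult_left_le_imp_le) simp
  have "(\<Prod>i=1..n. real (d i choose (d i div 2))) = (\<Prod>i=1..n. fact (d i) / (fact (k i))\<^sup>2)"
  proof (intro prod.cong refl)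
    fix i assume "i \<in> {1..n}"
    then show "real (d i choose (d i div 2)) = fact (d i) / (fact (k i))\<^sup>2"
      using dk[of i] binomial_fact[of "k i" "d i", where ?'a = real]
      by (simp add: power2_eq_square flip: k_def)
  qed
  also have "\<dots> = pd / pk\<^sup>2"
    by (simp only: pd_def pk_def prod_dividef prod_power_distrib)
  finally have rho: "exp (real n * rho_hat n d) = pd / pk\<^sup>2 / 2 ^ m"
    using d n by (subst exp_rho_hat) (auto simp: m_def k_def)
  \<comment> \<open>The degree sum gives \<open>2 * m \<le> n * \<Delta>\<close>; the leftover
    factor \<open>2 * \<Delta>\<close> under the root is absorbed by an exponential, raising the
    exponent from 4 to 6 times \<open>\<Delta>\<^sup>2\<close>.\<close>
  have root: "2 * sqrt (real m) \<le> sqrt (real n) * exp (2 * (real \<Delta>)\<^sup>2)"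
  proof -
    have "2 * m \<le> n * \<Delta>"
      using sum_bounded_above[of "{1..n}" d \<Delta>] d unfolding sum_d by simp
    then have "real (2 * m) \<le> real (n * \<Delta>)"
      by (rule of_nat_mono)
    then have "4 * real m \<le> real n * (2 * real \<Delta>)"
      by (simp add: algebra_simps)
    also have "\<dots> \<le> real n * exp (4 * (real \<Delta>)\<^sup>2)"
    proof (rule mult_left_mono)
      have "0 \<le> (2 * real \<Delta> - 1)\<^sup>2"
        by simp
      then have "2 * real \<Delta> \<le> 1 + 4 * (real \<Delta>)\<^sup>2"
        by (simp add: power2_eq_square algebra_simps)
      also have "\<dots> \<le> exp (4 * (real \<Delta>)\<^sup>2)"
        by (rule exp_ge_add_one_self)
      finally show "2 * real \<Delta> \<le> exp (4 * (real \<Delta>)\<^sup>2)" .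
    qed simp
    finally have "4 * real m \<le> real n * exp (4 * (real \<Delta>)\<^sup>2)" .
    then have "(2 * sqrt (real m))\<^sup>2 \<le> (sqrt (real n) * exp (2 * (real \<Delta>)\<^sup>2))\<^sup>2"
      by (simp add: power_mult_distrib flip: exp_of_nat_mult)
    then show ?thesis by (rule power2_le_imp_le) simp
  qed
  have N: "0 \<le> N" by (simp add: N_def)
  \<comment> \<open>The two counts are multiplied crosswise, so that \<open>fact (2 * m)\<close> can
    be cancelled at the end.\<close>
  have "SE * pk\<^sup>2 * 4 ^ m * fact (2 * m) \<le> fact m * 4 ^ m * (E * N * (fact m * 2 ^ m) * pd)"
    using upper lower by (intro mult_mono) auto
  also have "\<dots> = E * N * 2 ^ m * pd * (4 ^ m * (fact m)\<^sup>2)"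
    by (simp add: power2_eq_square)
  also have "\<dots> \<le> E * N * 2 ^ m * pd * (2 * sqrt (real m) * fact (2 * m))"
    using pos N by (intro mult_left_mono fact_square_le m) auto
  also have "\<dots> \<le> E * N * 2 ^ m * pd * (sqrt (real n) * exp (2 * (real \<Delta>)\<^sup>2) * fact (2 * m))"
    using pos N by (intro mult_left_mono mult_right_mono root) auto
  also have "\<dots> = N * (sqrt (real n) * exp (6 * (real \<Delta>)\<^sup>2)) * 2 ^ m * pd * fact (2 * m)"
    by (simp add: E_def flip: exp_add)
  finally have "SE * pk\<^sup>2 * 4 ^ m \<le> N * (sqrt (real n) * exp (6 * (real \<Delta>)\<^sup>2)) * 2 ^ m * pd"
    by simp
  also have "(4 :: real) ^ m = 2 ^ m * 2 ^ m"
    by (simp flip: power_mult_distrib)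
  finally have "SE \<le> N * (sqrt (real n) * exp (6 * (real \<Delta>)\<^sup>2)) * (pd / pk\<^sup>2 / 2 ^ m)"
    using pos by (simp add: field_simps)
  then show ?thesis
    by (simp add: SE_def N_def rho mult.assoc)
qed

section \<open>Markov's inequality and the asymptotic statement\<close>

lemma prob_rho_ge_le:
  assumes graphical: "graphical n d" and n: "0 < n"
    and d: "\<And>i. i \<in> {1..n} \<Longrightarrow> 0 < d i \<and> even (d i) \<and> d i \<le> \<Delta>"
    and \<Delta>: "12 * \<Delta>\<^sup>2 \<le> (\<Sum>i=1..n. d i)" and \<mu>: "0 < \<mu>"
  shows "measure_pmf.prob (random_graph n d) {G. rho n G \<ge> rho_hat n d + \<mu>}
    \<le> 1 / (exp (real n * \<mu>) - 1) * real n powr (1 / 2) * exp (6 * (real \<Delta>)\<^sup>2)"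
proof -
  let ?\<G> = "graphs_with_degrees n d"
  define N where "N = real (card ?\<G>)"
  define S where "S = {G \<in> ?\<G>. rho n G \<ge> rho_hat n d + \<mu>}"
  define H where "H = exp (real n * rho_hat n d)"
  define U where "U = sqrt (real n) * exp (6 * (real \<Delta>)\<^sup>2)"
  have ne: "?\<G> \<noteq> {}"
    using graphical by (simp add: graphical_def)
  have fin: "finite ?\<G>" "finite S"
    by (simp_all add: S_def finite_graphs_with_degrees)
  have N: "0 < N"
    using ne fin by (simp add: N_def card_gt_0_iff)
  have H: "0 < H" by (simp add: H_def)
  have \<Delta>1: "1 \<le> \<Delta>"
    using d[of 1] n by auto
  have EO: "H * exp (real n * \<mu>) \<le> real (EO G)" if "G \<in> S" for G
  proof -
    have le: "real n * (rho_hat n d + \<mu>) \<le> ln (real (EO G))"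
      using that n by (simp add: S_def rho_def field_simps)
    have "0 < real n * (rho_hat n d + \<mu>)"
      using n \<mu> rho_hat_nonneg[of n d] d by (intro mult_pos_pos add_nonneg_pos) auto
    then have "0 < real (EO G)"
      using le by (cases "EO G = 0") auto
    then have "exp (real n * (rho_hat n d + \<mu>)) \<le> real (EO G)"
      using le by (simp add: ln_ge_iff)
    then show ?thesis by (simp add: H_def distrib_left exp_add)
  qed
  have "real (card S) * (H * exp (real n * \<mu>)) = (\<Sum>G\<in>S. H * exp (real n * \<mu>))"
    by simp
  also have "\<dots> \<le> (\<Sum>G\<in>S. real (EO G))"
    by (intro sum_mono EO)
  also have "\<dots> \<le> (\<Sum>G\<in>?\<G>. real (EO G))"
    by (intro sum_mono2) (auto simp: fin S_def)
  also have "\<dots> \<le> N * (U * H)"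
    using sum_EO_le_card_graphs[OF n _ \<Delta>1 \<Delta>] d by (simp add: N_def U_def H_def)
  finally have "real (card S) * exp (real n * \<mu>) * H \<le> N * U * H"
    by (simp add: mult_ac)
  then have "real (card S) * exp (real n * \<mu>) \<le> N * U"
    using H by simp
  then have "real (card S) / N \<le> U / exp (real n * \<mu>)"
    using N by (simp add: field_simps)
  \<comment> \<open>Markov's inequality gives the factor \<open>1 / exp (n * \<mu>)\<close>; as
    \<open>n * \<mu>\<close> is positive, subtracting 1 keeps the denominator positive and only
    weakens the bound.\<close>
  also have "\<dots> \<le> U / (exp (real n * \<mu>) - 1)"
    using n \<mu> by (intro divide_left_mono mult_pos_pos) (auto simp: U_def)
  finally have "real (card S) / N \<le> U / (exp (real n * \<mu>) - 1)" .
  moreover have "measure_pmf.prob (random_graph n d) {G. rho n G \<ge> rho_hat n d + \<mu>} = real (card S) / N"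
  proof -
    have "?\<G> \<inter> {G. rho n G \<ge> rho_hat n d + \<mu>} = S" by (auto simp: S_def)
    then show ?thesis
      by (simp add: random_graph_def measure_pmf_of_set[OF ne fin(1)] N_def)
  qed
  ultimately show ?thesis
    by (simp add: U_def powr_half_sqrt)
qed

theorem theorem4p2:
  fixes d :: "nat \<Rightarrow> nat \<Rightarrow> nat"
  assumes "\<forall>\<^sub>F n in sequentially. graphical n (d n)"
    and "\<forall>\<^sub>F n in sequentially. \<forall>i\<in>{1..n}. 0 < d n i \<and> even (d n i)"
    and "(\<lambda>n. (real (max_degree n (d n)))\<^sup>2) \<in> o(\<lambda>n. avg_degree n (d n) * real n)"
  shows "\<exists>g :: nat \<Rightarrow> real. g \<in> O(\<lambda>n. (real (max_degree n (d n)))\<^sup>2) \<and>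
           (\<forall>\<^sub>F n in sequentially. \<forall>\<mu> :: real. 0 < \<mu> \<longrightarrow>
              measure_pmf.prob (random_graph n (d n)) {G. rho n G \<ge> rho_hat n (d n) + \<mu>}
                \<le> 1 / (exp (real n * \<mu>) - 1) * real n powr (1/2) * exp (g n))"
proof (intro exI conjI)
  \<comment> \<open>The explicit exponent of \<open>prob_rho_ge_le\<close> is the witness; it is
    chosen before \<mu>.\<close>
  show "(\<lambda>n. 6 * (real (max_degree n (d n)))\<^sup>2) \<in> O(\<lambda>n. (real (max_degree n (d n)))\<^sup>2)"
    by simp
  \<comment> \<open>The little-o hypothesis is used only with the constant 1/12, which yields
    \<open>12 * \<Delta>\<^sup>2\<close> below the degree sum, that is,
    \<open>6 * \<Delta>\<^sup>2\<close> below the number of edges.\<close>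
  have "\<forall>\<^sub>F n in sequentially. norm ((real (max_degree n (d n)))\<^sup>2) \<le> 1 / 12 * norm (avg_degree n (d n) * real n)"
    using landau_o.smallD[OF assms(3), of "1 / 12"] by simp
  with assms(1,2) eventually_gt_at_top[of 0]
  show "\<forall>\<^sub>F n in sequentially. \<forall>\<mu> :: real. 0 < \<mu> \<longrightarrow>
      measure_pmf.prob (random_graph n (d n)) {G. rho n G \<ge> rho_hat n (d n) + \<mu>}
        \<le> 1 / (exp (real n * \<mu>) - 1) * real n powr (1/2) * exp (6 * (real (max_degree n (d n)))\<^sup>2)"
  proof eventually_elim
    case (elim n)
    have "avg_degree n (d n) * real n = real (\<Sum>i=1..n. d n i)"
      using elim(3) by (simp add: avg_degree_def)
    with elim(4) have "12 * (real (max_degree n (d n)))\<^sup>2 \<le> real (\<Sum>i=1..n. d n i)"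
      by (simp only: real_norm_def abs_of_nat abs_power2)
    then have "12 * (max_degree n (d n))\<^sup>2 \<le> (\<Sum>i=1..n. d n i)"
      by (metis of_nat_le_iff of_nat_mult of_nat_numeral of_nat_power)
    moreover have "d n i \<le> max_degree n (d n)" if "i \<in> {1..n}" for i
      using that by (simp add: max_degree_def)
    ultimately show ?case
      using elim by (intro allI impI prob_rho_ge_le) auto
  qed
qed

end
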